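(* Let $\gamma,\gamma_1\in[0,2\pi)$, let $n$ be a positive integer and $\theta\in\mathbb{R}$. Let $f=h+\overline{g}\in\mathcal{S}^0(H_{\gamma_1})$ with $$h(z)+e^{-2i\gamma_1}g(z)=\frac{z}{1-e^{i\gamma_1}z}$$ and dilatation $\omega(z)=g'(z)/h'(z)=e^{i\theta}z^n$. If $a\in\left[\frac{n-2}{n+2},1\right)$, then $f\ast f^a_\gamma$ is convex in the direction $-(\gamma_1+\gamma)$, where $f^a_\gamma=h^a_\gamma+\overline{g^a_\gamma}\in\mathcal{S}(H_\gamma)$ is the slanted half-plane mapping determined by $$h^a_\gamma(z)+e^{-2i\gamma}g^a_\gamma(z)=\frac{(1+a)z}{1-e^{i\gamma}z},\qquad \frac{(g^a_\gamma)'(z)}{(h^a_\gamma)'(z)}=-e^{2i\gamma}\frac{e^{i\gamma}z-a}{1-ae^{i\gamma}z}.$$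
   Context: $\mathbb{D}=\{z\in\mathbb{C}:|z|<1\}$. A complex-valued harmonic mapping $f$ on $\mathbb{D}$ is written canonically as $f=h+\overline{g}$ with $h,g$ analytic in $\mathbb{D}$ and $g(0)=0$; its dilatation is $\omega=g'/h'$. $\mathcal{H}$ is the class of harmonic $f=h+\overline{g}$ on $\mathbb{D}$ with $h(0)=g(0)=0$ and $h'(0)=1$. $\mathcal{S}_H$ is the family of all sense-preserving univalent harmonic mappings in $\mathcal{H}$ (sense-preserving and locally univalent means $|h'(z)|>|g'(z)|$ in $\mathbb{D}$). Slanted half-plane mappings: for $0\le\gamma<2\pi$, $\mathcal{S}(H_\gamma)$ is the class of $f=h+\overline{g}\in\mathcal{S}_H$ that map $\mathbb{D}$ onto $\{w:\operatorname{Re}(e^{i\gamma}w)>-(1+a)/2\}$ for some $-1<a<1$; such a mapping satisfies $h(z)+e^{-2i\gamma}g(z)=\frac{(1+a)z}{1-e^{i\gamma}z}$, so that $g'(0)=e^{2i\gamma}a$. $\mathcal{S}^0(H_\gamma)$ is the subclass of $\mathcal{S}(H_\gamma)$ with $a=0$. Explicitly, with $I_\gamma(z)=\frac{z}{1-e^{i\gamma}z}$, the mapping $f^a_\gamma$ is given by $h^a_\gamma(z)=\frac{(1+a)I_\gamma(z)+(1-a)zI_\gamma'(z)}{2}$ and $g^a_\gamma(z)=e^{2i\gamma}\,\frac{(1+a)I_\gamma(z)-(1-a)zI_\gamma'(z)}{2}$. Convolution: for $f=h+\overline{g}$ and $F=H+\overline{G}$ in $\mathcal{H}$, with $h(z)=\sum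 a_nz^n$, $g(z)=\sum b_nz^n$, $H(z)=\sum A_nz^n$, $G(z)=\sum B_nz^n$, set $f\ast F=h\ast H+\overline{g\ast G}$, where $(h\ast H)(z)=\sum a_nA_nz^n$ and $(g\ast G)(z)=\sum b_nB_nz^n$ (Hadamard product). "Convex in the direction $\alpha$" ($\alpha$ real, understood modulo $\pi$), said of a harmonic mapping $f$ on $\mathbb{D}$, means that $f$ is univalent and the intersection of $f(\mathbb{D})$ with each line parallel to the line through $0$ and $e^{i\alpha}$ is an interval (connected) or empty. *)

theory Defs
  imports "HOL-Complex_Analysis.Complex_Analysis"
begin

abbreviation unit_disc :: "complex set" ("\<D>") where
  "\<D> \<equiv> ball 0 1"

(* A harmonic mapping of the disc is handled through the pair (h, g) of its canonical
   decomposition f = h + cnj g with g 0 = 0, which determines f and is determined by it. *)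

type_synonym harmonic_pair = "(complex \<Rightarrow> complex) \<times> (complex \<Rightarrow> complex)"

definition harmonic_map :: "harmonic_pair \<Rightarrow> complex \<Rightarrow> complex" where
  "harmonic_map f z = fst f z + cnj (snd f z)"

definition class_H :: "harmonic_pair set" where
  "class_H = {(h, g). h holomorphic_on \<D> \<and> g holomorphic_on \<D> \<and>
                h 0 = 0 \<and> g 0 = 0 \<and> deriv h 0 = 1}"

definition class_SH :: "harmonic_pair set" where
  "class_SH = {(h, g) \<in> class_H.
                (\<forall>z\<in>\<D>. norm (deriv g z) < norm (deriv h z)) \<and>
                inj_on (harmonic_map (h, g)) \<D>}"

definition slanted_half_plane :: "real \<Rightarrow> real \<Rightarrow> complex set" where
  "slanted_half_plane \<gamma> a = {w. Re (cis \<gamma> * w) > - (1 + a) / 2}"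

definition SH_half_plane :: "real \<Rightarrow> harmonic_pair set" where
  "SH_half_plane \<gamma> = {f \<in> class_SH. \<exists>a. -1 < a \<and> a < 1 \<and>
                        harmonic_map f ` \<D> = slanted_half_plane \<gamma> a}"

definition SH0_half_plane :: "real \<Rightarrow> harmonic_pair set" where
  "SH0_half_plane \<gamma> = {f \<in> class_SH. harmonic_map f ` \<D> = slanted_half_plane \<gamma> 0}"

definition I_map :: "real \<Rightarrow> complex \<Rightarrow> complex" where
  "I_map \<gamma> z = z / (1 - cis \<gamma> * z)"

definition h_slant :: "real \<Rightarrow> real \<Rightarrow> complex \<Rightarrow> complex" where
  "h_slant a \<gamma> z =
     (of_real (1 + a) * I_map \<gamma> z + of_real (1 - a) * z * deriv (I_map \<gamma>) z) / 2"

definition g_slant :: "real \<Rightarrow> real \<Rightarrow> complex \<Rightarrow> complex" where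
  "g_slant a \<gamma> z = cis (2 * \<gamma>) *
     (of_real (1 + a) * I_map \<gamma> z - of_real (1 - a) * z * deriv (I_map \<gamma>) z) / 2"

definition f_slant :: "real \<Rightarrow> real \<Rightarrow> harmonic_pair" where
  "f_slant a \<gamma> = (h_slant a \<gamma>, g_slant a \<gamma>)"

definition hadamard :: "(complex \<Rightarrow> complex) \<Rightarrow> (complex \<Rightarrow> complex) \<Rightarrow> complex \<Rightarrow> complex" where
  "hadamard p q = eval_fps (Abs_fps (\<lambda>k. fps_nth (fps_expansion p 0) k * fps_nth (fps_expansion q 0) k))"

definition harmonic_conv :: "harmonic_pair \<Rightarrow> harmonic_pair \<Rightarrow> harmonic_pair" (infixl "\<^bold>*" 70) where
  "f \<^bold>* F = (hadamard (fst f) (fst F), hadamard (snd f) (snd F))"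

definition convex_in_direction :: "real \<Rightarrow> (complex \<Rightarrow> complex) \<Rightarrow> bool" where
  "convex_in_direction \<alpha> f \<longleftrightarrow> inj_on f \<D> \<and>
     (\<forall>p. connected (f ` \<D> \<inter> range (\<lambda>t::real. p + of_real t * cis \<alpha>)))"


lemma slant_denom_nz: "z \<in> \<D> \<Longrightarrow> 1 - cis \<gamma> * z \<noteq> 0"
  by (metis dist_0_norm eq_iff_diff_eq_0 less_irrefl mem_ball mult_1 norm_cis norm_mult norm_one)

lemma deriv_I_map: "z \<in> \<D> \<Longrightarrow> deriv (I_map \<gamma>) z = 1 / (1 - cis \<gamma> * z)\<^sup>2"
  using slant_denom_nz[of z \<gamma>] unfolding I_map_def
  by (intro DERIV_imp_deriv) (auto intro!: derivative_eq_intros simp: power2_eq_square field_simps)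

lemma slant_sum:
  "h_slant a \<gamma> z + cis (- 2 * \<gamma>) * g_slant a \<gamma> z = of_real (1 + a) * z / (1 - cis \<gamma> * z)"
proof -
  have "cis (- 2 * \<gamma>) * cis (2 * \<gamma>) = 1" by (simp add: cis_mult)
  hence "cis (- 2 * \<gamma>) * g_slant a \<gamma> z =
     (of_real (1 + a) * I_map \<gamma> z - of_real (1 - a) * z * deriv (I_map \<gamma>) z) / 2"
    unfolding g_slant_def by (metis (no_types, lifting) mult.assoc mult_1 times_divide_eq_right)
  moreover have "(X + Y) / 2 + (X - Y) / 2 = X" for X Y :: complex
    by (simp add: add_divide_distrib diff_divide_distrib)
  ultimately have "h_slant a \<gamma> z + cis (- 2 * \<gamma>) * g_slant a \<gamma> z = of_real (1 + a) * I_map \<gamma> z"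
    unfolding h_slant_def by metis
  thus ?thesis by (simp add: I_map_def)
qed

lemma slant_has_deriv:
  assumes z: "z \<in> \<D>"
  shows "(h_slant a \<gamma> has_field_derivative (1 - of_real a * cis \<gamma> * z) / (1 - cis \<gamma> * z) ^ 3) (at z)"
    and "(g_slant a \<gamma> has_field_derivative
            cis (2 * \<gamma>) * (of_real a - cis \<gamma> * z) / (1 - cis \<gamma> * z) ^ 3) (at z)"
proof -
  define c where "c = cis \<gamma>"
  define A where "A = complex_of_real a"
  have nz: "1 - c * z \<noteq> 0" using slant_denom_nz[OF z] by (simp add: c_def)
  have I: "((\<lambda>w. w / (1 - c * w)) has_field_derivative (1 - c * z) / (1 - c * z)^3) (at z)"
    using nz by (auto intro!: derivative_eq_intros simp: power2_eq_square power3_eq_cube divide_simps)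
  have J: "((\<lambda>w. w / (1 - c * w)\<^sup>2) has_field_derivative (1 + c * z) / (1 - c * z)^3) (at z)"
  proof -
    have "((\<lambda>w. w / (1 - c * w)\<^sup>2) has_field_derivative
        (1 * (1 - c * z)\<^sup>2 - z * (2 * (1 - c * z) * (- c))) / ((1 - c * z)\<^sup>2 * (1 - c * z)\<^sup>2)) (at z)"
      using nz by (intro DERIV_divide) (auto intro!: derivative_eq_intros)
    moreover have "1 * (1 - c * z)\<^sup>2 - z * (2 * (1 - c * z) * (- c)) = (1 - c * z) * (1 + c * z)"
      by (simp add: algebra_simps power2_eq_square)
    moreover have "(1 - c * z)\<^sup>2 * (1 - c * z)\<^sup>2 = (1 - c * z) * (1 - c * z)^3"
      by (simp add: power2_eq_square power3_eq_cube mult_ac)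
    ultimately show ?thesis using nz by simp
  qed
  have E: "eventually (\<lambda>w. w \<in> \<D>) (nhds z)" using z by (intro eventually_nhds_in_open) auto
  have h: "((\<lambda>w. ((1 + A) * (w / (1 - c * w)) + (1 - A) * (w / (1 - c * w)\<^sup>2)) / 2)
      has_field_derivative ((1 + A) * ((1 - c * z) / (1 - c * z)^3) + (1 - A) * ((1 + c * z) / (1 - c * z)^3)) / 2) (at z)"
    by (intro DERIV_cdivide DERIV_add DERIV_cmult I J)
  have g: "((\<lambda>w. cis (2 * \<gamma>) * (((1 + A) * (w / (1 - c * w)) - (1 - A) * (w / (1 - c * w)\<^sup>2)) / 2))
      has_field_derivative cis (2 * \<gamma>) * (((1 + A) * ((1 - c * z) / (1 - c * z)^3) - (1 - A) * ((1 + c * z) / (1 - c * z)^3)) / 2)) (at z)"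
    by (intro DERIV_cdivide DERIV_diff DERIV_cmult I J)
  have eh: "((1 + A) * ((1 - c * z) / (1 - c * z)^3) + (1 - A) * ((1 + c * z) / (1 - c * z)^3)) / 2
     = (1 - A * c * z) / (1 - c * z)^3" using nz by (simp add: divide_simps) (simp add: algebra_simps)
  have eg: "cis (2 * \<gamma>) * (((1 + A) * ((1 - c * z) / (1 - c * z)^3) - (1 - A) * ((1 + c * z) / (1 - c * z)^3)) / 2)
     = cis (2 * \<gamma>) * (A - c * z) / (1 - c * z)^3" using nz by (simp add: divide_simps) (simp add: algebra_simps)
  have ch: "eventually (\<lambda>w. ((1 + A) * (w / (1 - c * w)) + (1 - A) * (w / (1 - c * w)\<^sup>2)) / 2 = h_slant a \<gamma> w) (nhds z)"
    using E by eventually_elim (simp add: h_slant_def deriv_I_map, simp add: I_map_def A_def c_def)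
  have cg: "eventually (\<lambda>w. cis (2 * \<gamma>) * (((1 + A) * (w / (1 - c * w)) - (1 - A) * (w / (1 - c * w)\<^sup>2)) / 2) = g_slant a \<gamma> w) (nhds z)"
    using E by eventually_elim (simp add: g_slant_def deriv_I_map, simp add: I_map_def A_def c_def)
  show "(h_slant a \<gamma> has_field_derivative (1 - of_real a * cis \<gamma> * z) / (1 - cis \<gamma> * z) ^ 3) (at z)"
    using h unfolding DERIV_cong_ev[OF refl ch eh] by (simp only: A_def c_def)
  show "(g_slant a \<gamma> has_field_derivative
            cis (2 * \<gamma>) * (of_real a - cis \<gamma> * z) / (1 - cis \<gamma> * z) ^ 3) (at z)"
    using g unfolding DERIV_cong_ev[OF refl cg eg] by (simp only: A_def c_def)
qed

lemma slant_dilatation: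
  assumes z: "z \<in> \<D>"
  shows "deriv (g_slant a \<gamma>) z / deriv (h_slant a \<gamma>) z =
           - cis (2 * \<gamma>) * (cis \<gamma> * z - of_real a) / (1 - of_real a * cis \<gamma> * z)"
proof -
  have "(p / d) / (q / d) = p / q" if "d \<noteq> 0" for p q d :: complex
    using that by simp
  moreover have "(1 - cis \<gamma> * z) ^ 3 \<noteq> 0" using slant_denom_nz[OF z] by simp
  moreover have "cis (2 * \<gamma>) * (of_real a - cis \<gamma> * z) = - cis (2 * \<gamma>) * (cis \<gamma> * z - of_real a)"
    by (simp add: algebra_simps)
  ultimately show ?thesis
    unfolding slant_has_deriv(1)[OF z, THEN DERIV_imp_deriv] slant_has_deriv(2)[OF z, THEN DERIV_imp_deriv]
    by metis
qed

lemma slant_map: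
  assumes z: "z \<in> \<D>" and k: "k = cis \<gamma> * z / (1 - cis \<gamma> * z)"
  shows "cis \<gamma> * harmonic_map (f_slant a \<gamma>) z =
           Complex ((1 + a) * Re k) ((1 - a) * (Im k * (1 + 2 * Re k)))"
proof -
  define c where "c = cis \<gamma>"
  have nz: "1 - c * z \<noteq> 0" using slant_denom_nz[OF z] by (simp add: c_def)
  have c1: "c * cnj c = 1" by (simp add: c_def cis_cnj cis_mult)
  have q: "c * z / (1 - c * z)\<^sup>2 = k + k\<^sup>2"
    using nz unfolding k c_def[symmetric] by (simp add: divide_simps) (simp add: algebra_simps power2_eq_square)
  have 1: "c * h_slant a \<gamma> z = (of_real (1 + a) * k + of_real (1 - a) * (k + k\<^sup>2)) / 2"
    unfolding h_slant_def deriv_I_map[OF z] q[symmetric] by (simp add: I_map_def k c_def algebra_simps)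
  have c2: "cis (2 * \<gamma>) = c * c" by (simp add: c_def cis_mult)
  have g: "g_slant a \<gamma> z = c * ((of_real (1 + a) * k - of_real (1 - a) * (k + k\<^sup>2)) / 2)"
    unfolding g_slant_def deriv_I_map[OF z] q[symmetric] c2 by (simp add: I_map_def k c_def algebra_simps)
  have 2: "c * cnj (g_slant a \<gamma> z) = cnj ((of_real (1 + a) * k - of_real (1 - a) * (k + k\<^sup>2)) / 2)"
    unfolding g complex_cnj_mult mult.assoc[symmetric] c1 by simp
  have "c * harmonic_map (f_slant a \<gamma>) z = c * h_slant a \<gamma> z + c * cnj (g_slant a \<gamma> z)"
    by (simp add: harmonic_map_def f_slant_def algebra_simps)
  also have "\<dots> = Complex ((1 + a) * Re k) ((1 - a) * (Im k * (1 + 2 * Re k)))"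
    unfolding 1 2 by (simp add: complex_eq_iff power2_eq_square) (simp add: field_simps)
  finally show ?thesis by (simp add: c_def)
qed

lemma moebius_bij: "bij_betw (\<lambda>z. cis \<gamma> * z / (1 - cis \<gamma> * z)) \<D> {k. Re k > - 1/2}"
proof (rule bij_betw_byWitness[where f' = "\<lambda>k. cis (- \<gamma>) * (k / (1 + k))"])
  have cc: "cis (- \<gamma>) * cis \<gamma> = 1" "cis \<gamma> * cis (- \<gamma>) = 1" by (simp_all add: cis_mult)
  show "\<forall>z\<in>\<D>. cis (- \<gamma>) * (cis \<gamma> * z / (1 - cis \<gamma> * z) / (1 + cis \<gamma> * z / (1 - cis \<gamma> * z))) = z"
  proof
    fix z assume "z \<in> \<D>"
    hence nz: "1 - cis \<gamma> * z \<noteq> 0" by (rule slant_denom_nz)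
    have "cis \<gamma> * z / (1 - cis \<gamma> * z) / (1 + cis \<gamma> * z / (1 - cis \<gamma> * z)) = cis \<gamma> * z"
      using nz by (simp add: divide_simps)
    thus "cis (- \<gamma>) * (cis \<gamma> * z / (1 - cis \<gamma> * z) / (1 + cis \<gamma> * z / (1 - cis \<gamma> * z))) = z"
      by (simp add: cc(1) mult.assoc[symmetric])
  qed
  have key: "cis \<gamma> * (cis (- \<gamma>) * (k / (1 + k))) = k / (1 + k)" for k
    by (simp add: cc(2) mult.assoc[symmetric])
  have nz: "1 + k \<noteq> 0" if "Re k > - 1/2" for k using that by (auto simp: complex_eq_iff)
  show "\<forall>k\<in>{k. Re k > - 1/2}. cis \<gamma> * (cis (- \<gamma>) * (k / (1 + k))) /
           (1 - cis \<gamma> * (cis (- \<gamma>) * (k / (1 + k)))) = k"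
    unfolding key using nz by (auto simp: divide_simps)
  show "(\<lambda>z. cis \<gamma> * z / (1 - cis \<gamma> * z)) ` \<D> \<subseteq> {k. Re k > - 1/2}"
  proof safe
    fix z assume z: "z \<in> \<D>"
    define u where "u = cis \<gamma> * z"
    have u: "norm u < 1" using z by (simp add: u_def norm_mult)
    hence u2: "(Re u)\<^sup>2 + (Im u)\<^sup>2 < 1" by (simp add: cmod_def)
    have nz: "1 - u \<noteq> 0" using slant_denom_nz[OF z] by (simp add: u_def)
    have p: "(1 - Re u)\<^sup>2 + (Im u)\<^sup>2 > 0" using nz
      by (auto simp: complex_eq_iff sum_power2_gt_zero_iff)
    show "- 1/2 < Re (cis \<gamma> * z / (1 - cis \<gamma> * z))"
      using p u2 unfolding u_def[symmetric]
      by (simp add: Re_divide field_simps power2_eq_square)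
  qed
  show "(\<lambda>k. cis (- \<gamma>) * (k / (1 + k))) ` {k. Re k > - 1/2} \<subseteq> \<D>"
  proof safe
    fix k assume k: "Re k > - 1/2"
    have "(norm k)\<^sup>2 < (norm (1 + k))\<^sup>2" using k
      unfolding cmod_power2 by (simp add: power2_eq_square algebra_simps)
    hence "norm k < norm (1 + k)" by (rule power2_less_imp_less) simp
    thus "cis (- \<gamma>) * (k / (1 + k)) \<in> \<D>" using nz[OF k] by (simp add: norm_mult norm_divide)
  qed
qed

lemma slant_half_plane_image:
  assumes a: "-1 < a" "a < 1"
  shows "bij_betw (harmonic_map (f_slant a \<gamma>)) \<D> (slanted_half_plane \<gamma> a)"
proof -
  define M where "M = (\<lambda>z. cis \<gamma> * z / (1 - cis \<gamma> * z))"
  define P where "P = (\<lambda>k. Complex ((1 + a) * Re k) ((1 - a) * (Im k * (1 + 2 * Re k))))"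
  have cc: "cis (- \<gamma>) * cis \<gamma> = 1" "cis \<gamma> * cis (- \<gamma>) = 1" by (simp_all add: cis_mult)
  have B1: "bij_betw M \<D> {k. Re k > - 1/2}" unfolding M_def by (rule moebius_bij)
  have B2: "bij_betw P {k. Re k > - 1/2} {w. Re w > - (1 + a) / 2}"
  proof (rule bij_betw_byWitness[where
        f' = "\<lambda>w. Complex (Re w / (1 + a)) (Im w / ((1 - a) * (1 + 2 * (Re w / (1 + a)))))"])
    have pos: "1 + 2 * (Re w / (1 + a)) > 0" if "Re w > - (1 + a) / 2" for w
      using that a by (simp add: field_simps)
    show "\<forall>k\<in>{k. Re k > - 1/2}. Complex (Re (P k) / (1 + a))
        (Im (P k) / ((1 - a) * (1 + 2 * (Re (P k) / (1 + a))))) = k"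
      using a by (auto simp: P_def complex_eq_iff)
    show "\<forall>w\<in>{w. Re w > - (1 + a) / 2}. P (Complex (Re w / (1 + a))
        (Im w / ((1 - a) * (1 + 2 * (Re w / (1 + a)))))) = w"
    proof safe
      fix w assume "- (1 + a) / 2 < Re w"
      hence "1 + 2 * (Re w / (1 + a)) \<noteq> 0" using pos[of w] by simp
      thus "P (Complex (Re w / (1 + a)) (Im w / ((1 - a) * (1 + 2 * (Re w / (1 + a)))))) = w"
        using a by (simp add: P_def complex_eq_iff)
    qed
    have "- (1 + a) / 2 < (1 + a) * x" if "- 1/2 < x" for x
      using mult_strict_left_mono[OF that, of "1 + a"] a by (simp add: field_simps)
    thus "P ` {k. Re k > - 1/2} \<subseteq> {w. Re w > - (1 + a) / 2}" by (auto simp: P_def)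
    show "(\<lambda>w. Complex (Re w / (1 + a)) (Im w / ((1 - a) * (1 + 2 * (Re w / (1 + a)))))) `
            {w. Re w > - (1 + a) / 2} \<subseteq> {k. Re k > - 1/2}"
      using a by (auto simp: field_simps)
  qed
  have B3: "bij_betw (\<lambda>w. cis (- \<gamma>) * w) {w. Re w > - (1 + a) / 2} (slanted_half_plane \<gamma> a)"
  proof (rule bij_betw_byWitness[where f' = "\<lambda>w. cis \<gamma> * w"])
    have e: "cis \<gamma> * (cis (- \<gamma>) * w) = w" "cis (- \<gamma>) * (cis \<gamma> * w) = w" for w
      by (simp_all only: mult.assoc[symmetric] cc mult_1)
    show "\<forall>w\<in>{w. Re w > - (1 + a) / 2}. cis \<gamma> * (cis (- \<gamma>) * w) = w"
      and "\<forall>w\<in>slanted_half_plane \<gamma> a. cis (- \<gamma>) * (cis \<gamma> * w) = w"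
      by (simp_all only: e ball_simps) simp_all
    show "(\<lambda>w. cis (- \<gamma>) * w) ` {w. Re w > - (1 + a) / 2} \<subseteq> slanted_half_plane \<gamma> a"
      unfolding slanted_half_plane_def image_subset_iff mem_Collect_eq ball_simps e by blast
    show "(\<lambda>w. cis \<gamma> * w) ` slanted_half_plane \<gamma> a \<subseteq> {w. Re w > - (1 + a) / 2}"
      unfolding slanted_half_plane_def by blast
  qed
  have B: "bij_betw ((\<lambda>w. cis (- \<gamma>) * w) \<circ> (P \<circ> M)) \<D> (slanted_half_plane \<gamma> a)"
    by (rule bij_betw_trans[OF bij_betw_trans[OF B1 B2] B3])
  have "harmonic_map (f_slant a \<gamma>) z = ((\<lambda>w. cis (- \<gamma>) * w) \<circ> (P \<circ> M)) z" if "z \<in> \<D>" for z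
    using slant_map[OF that refl, of \<gamma> a] cc(1) unfolding P_def M_def o_def
    by (metis mult.assoc mult_1)
  thus ?thesis using B by (subst bij_betw_cong) auto
qed

lemma f_slant_in_class_SH:
  assumes a: "-1 < a" "a < 1"
  shows "f_slant a \<gamma> \<in> class_SH"
proof -
  note D = slant_has_deriv[of _ a \<gamma>]
  have "norm (deriv (g_slant a \<gamma>) z) < norm (deriv (h_slant a \<gamma>) z)" if z: "z \<in> \<D>" for z
  proof -
    define u where "u = cis \<gamma> * z"
    have "norm u < 1" using z by (simp add: u_def norm_mult)
    hence u2: "(Re u)\<^sup>2 + (Im u)\<^sup>2 < 1" by (simp add: cmod_def)
    have "a\<^sup>2 < 1" using a by (simp add: abs_square_less_1)
    hence "0 < (1 - a\<^sup>2) * (1 - ((Re u)\<^sup>2 + (Im u)\<^sup>2))" using u2 by simp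
    hence "(norm (of_real a - u))\<^sup>2 < (norm (1 - of_real a * u))\<^sup>2"
      unfolding cmod_power2 by (simp add: power2_eq_square algebra_simps)
    hence "norm (of_real a - u) < norm (1 - of_real a * u)" by (rule power2_less_imp_less) simp
    thus ?thesis using slant_denom_nz[OF z, of \<gamma>] D[OF z, THEN DERIV_imp_deriv]
      by (simp add: norm_divide norm_mult norm_power u_def mult.assoc divide_strict_right_mono)
  qed
  moreover have "h_slant a \<gamma> holomorphic_on \<D>" "g_slant a \<gamma> holomorphic_on \<D>"
    using D by (meson DERIV_subset field_differentiable_def holomorphic_onI
        field_differentiable_at_within)+
  moreover have "h_slant a \<gamma> 0 = 0" "g_slant a \<gamma> 0 = 0"
    by (simp_all add: h_slant_def g_slant_def I_map_def)
  moreover have "deriv (h_slant a \<gamma>) 0 = 1" using D(1)[of 0, THEN DERIV_imp_deriv] by simp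
  ultimately show ?thesis using slant_half_plane_image[OF a, of \<gamma>]
    by (simp add: class_SH_def class_H_def f_slant_def bij_betw_def)
qed

lemma f_slant_in_SH_half_plane: "-1 < a \<Longrightarrow> a < 1 \<Longrightarrow> f_slant a \<gamma> \<in> SH_half_plane \<gamma>"
  using f_slant_in_class_SH slant_half_plane_image by (auto simp: SH_half_plane_def bij_betw_def)

lemma SH0_half_plane_subset: "SH0_half_plane \<gamma> \<subseteq> SH_half_plane \<gamma>"
  unfolding SH0_half_plane_def SH_half_plane_def by (auto intro!: exI[of _ 0])

end

(* The Hadamard product with a slanted half-plane mapping is an explicit first-order
   differential expression in h and g.  Take k = u / (1 - u), u = cis (\<gamma> + \<gamma>1) * z, as coordinate:
   the disc becomes the half-plane Re k > -1/2, and, up to a rotation, the convolution becomes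
   p + cnj q.  With W the rotated dilatation of (h, g) and P = (1 - W) / (1 + W),
     p' - q' = ((1 + a) P + (1 - a) (1 + 2 k)) / 2,
   whose real part is at least (1 - a) (1 + 2 Re k) / 2 > 0.  As Im (p + cnj q) = Im (p - q), each level
   set of the imaginary part is therefore a graph over the whole interval ]-1/2, \<infinity>[, hence
   connected, and the real part is increasing along it as soon as the Jacobian is positive.

   The inequality |q'| < |p'| reads |W| |A - S| < |A + S| with A = 2/(1-a) - (n+2)/2, which is
   nonnegative exactly when a \<ge> (n-2)/(n+2), and S = (1 + 2 k) + (n/2) P, which has positive real part. *)

theory Submission
  imports Defs
begin

section \<open>Power series: Hadamard products with the half-plane kernel\<close>

lemma inverse_one_minus_const_mult_fps_X:
  fixes c :: "'a :: field"
  shows "inverse (1 - fps_const c * fps_X) = Abs_fps (\<lambda>k. c ^ k)"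
proof (rule fps_inverse_unique)
  show "(1 - fps_const c * fps_X) * Abs_fps (\<lambda>k. c ^ k) = 1"
  proof (rule fps_ext)
    fix k
    show "fps_nth ((1 - fps_const c * fps_X) * Abs_fps (\<lambda>k. c ^ k)) k = fps_nth 1 k"
      by (cases k) (simp_all add: left_diff_distrib mult.assoc)
  qed
qed

lemma I_map_has_fps_expansion:
  "I_map \<gamma> has_fps_expansion fps_X * Abs_fps (\<lambda>k. cis \<gamma> ^ k)"
proof -
  have "(\<lambda>z. z * inverse (1 - cis \<gamma> * z)) has_fps_expansion
          fps_X * inverse (1 - fps_const (cis \<gamma>) * fps_X)"
    by (intro fps_expansion_intros) simp
  then show ?thesis
    by (simp add: I_map_def [abs_def] divide_inverse inverse_one_minus_const_mult_fps_X)
qed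

lemma has_fps_expansion_scale:
  fixes c :: complex
  assumes "f has_fps_expansion F"
  shows "(\<lambda>z. f (c * z)) has_fps_expansion Abs_fps (\<lambda>k. c ^ k * fps_nth F k)"
proof -
  have "(f \<circ> (\<lambda>z. c * z)) has_fps_expansion fps_compose F (fps_const c * fps_X)"
    by (intro has_fps_expansion_compose fps_expansion_intros assms) simp
  then show ?thesis
    unfolding o_def fps_compose_linear .
qed

text \<open>For positive k the k-th coefficient of \<open>I_map \<gamma>\<close> is
  \<open>cis \<gamma> ^ (k - 1)\<close>, so the Hadamard product with it is
  \<open>p (cis \<gamma> * z)\<close> divided by \<open>cis \<gamma>\<close>. The operator z d/dz
  multiplies coefficients by k and can be moved onto \<open>p\<close>. The hypothesis on
  \<open>p 0\<close> settles k = 0, where the kernel has coefficient zero but the rescaled side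
  would keep a constant term.\<close>

lemma hadamard_I_map_combination:
  assumes p: "p holomorphic_on \<D>" and p0: "p 0 = 0" and z: "z \<in> \<D>"
  shows "hadamard p (\<lambda>z. \<alpha> * I_map \<gamma> z + \<beta> * (z * deriv (I_map \<gamma>) z)) z =
           cis (- \<gamma>) * (\<alpha> * p (cis \<gamma> * z) + \<beta> * (cis \<gamma> * z * deriv p (cis \<gamma> * z)))"
proof -
  define P where "P = fps_expansion p 0"
  define J where "J = fps_X * Abs_fps (\<lambda>k. cis \<gamma> ^ k)"
  have P: "p has_fps_expansion P"
    unfolding P_def using p by (intro has_fps_expansion_fps_expansion[of \<D>]) auto
  define r where "r = (\<lambda>w. \<alpha> * p w + \<beta> * (w * deriv p w))"
  have r_exp: "r has_fps_expansion fps_const \<alpha> * P + fps_const \<beta> * (fps_X * fps_deriv P)"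
    unfolding r_def by (intro fps_expansion_intros P)
  have "(\<lambda>z. \<alpha> * I_map \<gamma> z + \<beta> * (z * deriv (I_map \<gamma>) z)) has_fps_expansion
          fps_const \<alpha> * J + fps_const \<beta> * (fps_X * fps_deriv J)"
    unfolding J_def by (intro fps_expansion_intros I_map_has_fps_expansion)
  then have E: "fps_expansion (\<lambda>z. \<alpha> * I_map \<gamma> z + \<beta> * (z * deriv (I_map \<gamma>) z)) 0 =
          fps_const \<alpha> * J + fps_const \<beta> * (fps_X * fps_deriv J)"
    by (rule fps_expansion_eqI)
  define R where "R = fps_const (cis (- \<gamma>)) *
      Abs_fps (\<lambda>k. cis \<gamma> ^ k * fps_nth (fps_const \<alpha> * P + fps_const \<beta> * (fps_X * fps_deriv P)) k)"
  have R: "(\<lambda>z. cis (- \<gamma>) * r (cis \<gamma> * z)) has_fps_expansion R"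
    unfolding R_def by (intro fps_expansion_intros has_fps_expansion_scale r_exp)
  have P0: "fps_nth P 0 = 0"
    using p0 by (simp add: P_def fps_expansion_def)
  have "Abs_fps (\<lambda>k. fps_nth P k * fps_nth (fps_const \<alpha> * J + fps_const \<beta> * (fps_X * fps_deriv J)) k) = R"
  proof (rule fps_ext)
    fix k
    let ?JJ = "fps_const \<alpha> * J + fps_const \<beta> * (fps_X * fps_deriv J)"
    let ?PP = "fps_const \<alpha> * P + fps_const \<beta> * (fps_X * fps_deriv P)"
    have "fps_nth P k * fps_nth ?JJ k = cis (- \<gamma>) * (cis \<gamma> ^ k * fps_nth ?PP k)"
    proof (cases k)
      case 0
      then show ?thesis by (simp add: P0)
    next
      case (Suc n)
      \<comment> \<open>The factor by which the first-order operator multiplies the k-th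
        coefficient, the same for \<open>J\<close> and for \<open>P\<close>.\<close>
      define A where "A = \<alpha> + \<beta> * of_nat (Suc n)"
      have "fps_nth ?JJ k = A * cis \<gamma> ^ n"
        by (cases n) (simp_all add: J_def A_def Suc algebra_simps)
      moreover have "fps_nth ?PP k = A * fps_nth P k"
        by (simp add: A_def Suc algebra_simps)
      moreover have "cis (- \<gamma>) * cis \<gamma> ^ k = cis \<gamma> ^ n"
        by (simp add: Suc mult.assoc [symmetric] cis_mult)
      ultimately show ?thesis
        by (metis mult.assoc mult.commute)
    qed
    then show "fps_nth (Abs_fps (\<lambda>k. fps_nth P k * fps_nth ?JJ k)) k = fps_nth R k"
      by (simp only: R_def fps_mult_left_const_nth fps_nth_Abs_fps)
  qed
  then have "hadamard p (\<lambda>z. \<alpha> * I_map \<gamma> z + \<beta> * (z * deriv (I_map \<gamma>) z)) z = eval_fps R z"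
    unfolding hadamard_def E P_def by simp
  \<comment> \<open>The expansion alone controls the function near 0; holomorphy on the whole disc
    makes the series represent it at \<open>z\<close>.\<close>
  also have "\<dots> = cis (- \<gamma>) * r (cis \<gamma> * z)"
  proof (rule has_fps_expansion_imp_eval_fps_eq[OF R])
    show "norm z < 1" using z by simp
    have "r holomorphic_on \<D>"
      unfolding r_def by (intro holomorphic_intros p) auto
    moreover have "(\<lambda>z. cis \<gamma> * z) ` \<D> \<subseteq> \<D>"
      by (auto simp: norm_mult)
    ultimately have "(r \<circ> (\<lambda>z. cis \<gamma> * z)) holomorphic_on \<D>"
      by (intro holomorphic_on_compose_gen[where t = \<D>] holomorphic_intros)
    then show "(\<lambda>z. cis (- \<gamma>) * r (cis \<gamma> * z)) holomorphic_on \<D>"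
      by (intro holomorphic_intros) (simp add: o_def)
  qed
  finally show ?thesis by (simp add: r_def)
qed

section \<open>Inequalities bounding the dilatation of the convolution\<close>

text \<open>The real part equals (1 - |w|^2) / |1 + w|^2; this is the Cayley transform of the disc
  onto the right half-plane.\<close>

lemma Re_one_minus_over_one_plus_pos:
  fixes w :: complex
  assumes "norm w < 1"
  shows "Re ((1 - w) / (1 + w)) > 0"
proof -
  have "(norm w)\<^sup>2 < 1" using assms by (simp add: abs_square_less_1)
  then have "(Re w)\<^sup>2 + (Im w)\<^sup>2 < 1" by (simp add: cmod_power2)
  moreover have "(1 + Re w)\<^sup>2 + (Im w)\<^sup>2 > 0"
  proof -
    have "1 + w \<noteq> 0" using assms by (metis add_eq_0_iff2 less_irrefl norm_minus_cancel norm_one)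
    then show ?thesis by (auto simp: sum_power2_gt_zero_iff complex_eq_iff)
  qed
  ultimately show ?thesis
    by (simp add: Re_divide power2_eq_square field_simps)
qed

text \<open>The squared norms differ by exactly 4 A Re S.\<close>

lemma norm_real_minus_le_norm_real_plus:
  assumes "A \<ge> 0" "Re S \<ge> 0"
  shows "norm (of_real A - S) \<le> norm (of_real A + S)"
proof (rule power2_le_imp_le)
  have "A * Re S \<ge> 0" using assms by simp
  then show "(norm (of_real A - S))\<^sup>2 \<le> (norm (of_real A + S))\<^sup>2"
    unfolding cmod_power2 by (simp add: power2_eq_square algebra_simps)
qed simp

text \<open>With \<open>d\<close> the exponent n, \<open>T\<close> the logarithmic derivative z h''
  / h', Q = 1 + 2 k and P = (1 - W) / (1 + W), the two sides are twice the numerators of q' and p'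
  over their common denominator 1 + W.\<close>

lemma dilatation_bound:
  fixes T P Q W :: complex and a d :: real
  assumes Q: "Re Q > 0" and P: "Re P \<ge> 0" and W: "norm W < 1"
    and T: "T = Q - 1 - of_real (d / 2) * (1 - P)"
    and d: "d \<ge> 0" and a: "(d - 2) / (d + 2) \<le> a" "a < 1"
  shows "norm (W * (2 * of_real a - of_real (1 - a) * (of_real d + T))) <
         norm (2 + of_real (1 - a) * T)"
proof -
  \<comment> \<open>Chosen so that, after division by 1 - a, the right-hand side is A + S and the
    left-hand side is W (A - S), with \<open>A\<close> real and all of \<open>T\<close> in
    \<open>S\<close>.\<close>
  define A where "A = 2 / (1 - a) - (d + 2) / 2"
  define S where "S = T + of_real ((d + 2) / 2)"
  have "(1 - a) * (d + 2) \<le> 4" using a d by (simp add: field_simps)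
  then have A: "A \<ge> 0" using a by (simp add: A_def field_simps)
  have "S = Q + of_real (d / 2) * P"
    by (simp add: S_def T field_simps)
  then have S: "Re S > 0" using Q P d by (simp add: add_pos_nonneg)
  have "norm (of_real A - S) \<le> norm (of_real A + S)"
    using A S by (intro norm_real_minus_le_norm_real_plus) auto
  \<comment> \<open>The comparison of A - S with A + S is only weak; strictness comes from |W| < 1,
    provided that A + S does not vanish.\<close>
  moreover have "norm (of_real A + S) > 0"
    using A S by (auto simp: complex_eq_iff)
  moreover have "norm W * norm (of_real A + S) < 1 * norm (of_real A + S)"
    using W calculation(2) by (intro mult_strict_right_mono) auto
  ultimately have "norm W * norm (of_real A - S) < norm (of_real A + S)"
    by (metis le_less_trans mult_1 mult_left_mono norm_ge_zero)
  then have "norm (of_real (1 - a) * (W * (of_real A - S))) < norm (of_real (1 - a) * (of_real A + S))"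
    using a by (simp only: norm_mult norm_of_real) simp
  moreover have A_eq: "complex_of_real (1 - a) * of_real A = of_real (2 - (1 - a) * ((d + 2) / 2))"
  proof -
    have "(1 - a) * (2 / (1 - a)) = 2" using a by (intro nonzero_mult_div_cancel_left[THEN trans[OF times_divide_eq_right]]) auto
    then have "(1 - a) * A = 2 - (1 - a) * ((d + 2) / 2)"
      by (simp only: A_def right_diff_distrib)
    then show ?thesis by (metis of_real_mult)
  qed
  have "of_real (1 - a) * (W * (of_real A - S)) =
      W * (2 * of_real a - of_real (1 - a) * (of_real d + T))"
    unfolding mult.left_commute[of _ W] right_diff_distrib[of "of_real (1 - a)"] A_eq
    by (simp add: S_def field_simps)
  moreover have "of_real (1 - a) * (of_real A + S) = 2 + of_real (1 - a) * T"
    unfolding distrib_left A_eq by (simp add: S_def field_simps)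
  ultimately show ?thesis by metis
qed

section \<open>Horizontal convexity of harmonic maps on a half-plane\<close>

(* Straightening: the map k |-> Re k + \<i> Im (p k - q k) is a bijection of the half-plane that turns
   the level sets of the imaginary part into horizontal lines.  The lower bound m, constant on
   vertical lines, is what makes it surjective. *)
lemma horizontally_convex_half_plane:
  fixes p q :: "complex \<Rightarrow> complex" and r :: real and m :: "real \<Rightarrow> real"
  defines "\<Omega> \<equiv> {k. Re k > r}"
  assumes p: "\<And>k. k \<in> \<Omega> \<Longrightarrow> (p has_field_derivative p' k) (at k)"
    and q: "\<And>k. k \<in> \<Omega> \<Longrightarrow> (q has_field_derivative q' k) (at k)"
    and J: "\<And>k. k \<in> \<Omega> \<Longrightarrow> norm (q' k) < norm (p' k)"
    and m: "\<And>x. x > r \<Longrightarrow> m x > 0"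
    and D: "\<And>k. k \<in> \<Omega> \<Longrightarrow> Re (p' k - q' k) \<ge> m (Re k)"
  shows "inj_on (\<lambda>k. p k + cnj (q k)) \<Omega>"
    and "connected ((\<lambda>k. p k + cnj (q k)) ` \<Omega> \<inter> {w. Im w = t})"
proof -
  define \<Phi> where "\<Phi> = (\<lambda>k. p k + cnj (q k))"
  define V where "V = (\<lambda>k. Im (p k - q k))"
  define \<Psi> where "\<Psi> = (\<lambda>k. Complex (Re k) (V k))"
  define \<Delta> where "\<Delta> = (\<lambda>k. p' k - q' k)"
  have opn: "open \<Omega>" unfolding \<Omega>_def by (rule open_halfspace_Re_gt)
  have Re\<Delta>: "Re (\<Delta> k) > 0" if "k \<in> \<Omega>" for k
    using D[OF that] m[of "Re k"] that by (simp add: \<Delta>_def \<Omega>_def)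
  have V_deriv: "(V has_derivative (\<lambda>e. Im (\<Delta> k * e))) (at k)" if "k \<in> \<Omega>" for k
  proof -
    have "((\<lambda>k. p k - q k) has_derivative (\<lambda>e. \<Delta> k * e)) (at k)"
      using DERIV_diff[OF p[OF that] q[OF that]]
      by (simp add: has_field_derivative_def \<Delta>_def)
    then show ?thesis unfolding V_def by (rule has_derivative_Im)
  qed
  have \<Psi>_deriv: "(\<Psi> has_derivative (\<lambda>e. Complex (Re e) (Im (\<Delta> k * e)))) (at k)"
    if "k \<in> \<Omega>" for k
  proof -
    have "((\<lambda>k. of_real (Re k) + \<i> * of_real (V k)) has_derivative
             (\<lambda>e. of_real (Re e) + \<i> * of_real (Im (\<Delta> k * e)))) (at k)"
      by (intro derivative_intros V_deriv that)
    then show ?thesis by (simp add: \<Psi>_def Complex_eq)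
  qed
  \<comment> \<open>A vertical increment is i times a real number, and Im (i \<Delta>) = Re
    \<Delta>.\<close>
  have V_line: "((\<lambda>y. V (Complex x y)) has_real_derivative Re (\<Delta> (Complex x y))) (at y)"
    if "x > r" for x y
  proof -
    have "((\<lambda>y. of_real x + \<i> * of_real y) has_derivative (\<lambda>s. \<i> * of_real s)) (at y)"
      by (auto intro!: derivative_eq_intros)
    then have "((\<lambda>y. Complex x y) has_derivative (\<lambda>s. \<i> * of_real s)) (at y)"
      by (simp add: Complex_eq)
    moreover have "(V has_derivative (\<lambda>e. Im (\<Delta> (Complex x y) * e))) (at (Complex x y))"
      using that by (intro V_deriv) (simp add: \<Omega>_def)
    ultimately have "((\<lambda>y. V (Complex x y)) has_derivative
        (\<lambda>s. Im (\<Delta> (Complex x y) * (\<i> * of_real s)))) (at y)"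
      by (rule has_derivative_compose)
    then show ?thesis
      by (simp add: has_field_derivative_def)
  qed
  \<comment> \<open>Growth at least linear with slope \<open>m x\<close> makes \<open>V\<close> both
    injective and onto the reals on each vertical line.\<close>
  have V_grow: "V (Complex x y2) - V (Complex x y1) \<ge> m x * (y2 - y1)"
    if x: "x > r" and y: "y1 \<le> y2" for x y1 y2
  proof -
    have "V (Complex x y1) - m x * y1 \<le> V (Complex x y2) - m x * y2"
    proof (rule DERIV_nonneg_imp_nondecreasing[OF y])
      fix y
      have "((\<lambda>y. V (Complex x y) - m x * y) has_real_derivative Re (\<Delta> (Complex x y)) - m x) (at y)"
        by (auto intro!: derivative_eq_intros V_line x)
      moreover have "Re (\<Delta> (Complex x y)) - m x \<ge> 0"
        using D[of "Complex x y"] x by (simp add: \<Omega>_def \<Delta>_def)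
      ultimately show "\<exists>l. ((\<lambda>y. V (Complex x y) - m x * y) has_real_derivative l) (at y) \<and> 0 \<le> l"
        by blast
    qed
    then show ?thesis by (simp add: algebra_simps)
  qed
  have inj: "inj_on \<Psi> \<Omega>"
  proof (rule inj_onI)
    fix k l assume k: "k \<in> \<Omega>" and l: "l \<in> \<Omega>" and eq: "\<Psi> k = \<Psi> l"
    have Re: "Re k = Re l" and Veq: "V k = V l" using eq by (auto simp: \<Psi>_def)
    have *: "u = v" if "u \<in> \<Omega>" "Re u = Re v" "V u = V v" "Im u \<le> Im v" for u v
    proof -
      have mp: "m (Re u) > 0" using that m by (simp add: \<Omega>_def)
      have "m (Re u) * (Im v - Im u) \<le> V (Complex (Re u) (Im v)) - V (Complex (Re u) (Im u))"
        using that by (intro V_grow) (auto simp: \<Omega>_def)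
      also have "\<dots> = 0" using that by (metis complex_surj diff_self)
      finally have "Im v - Im u \<le> 0" using mp by (simp add: mult_le_0_iff)
      then show ?thesis using that by (simp add: complex_eq_iff)
    qed
    show "k = l" using *[of k l] *[of l k] k l Re Veq by fastforce
  qed
  have img: "\<Psi> ` \<Omega> = \<Omega>"
  proof (intro equalityI subsetI)
    fix w assume "w \<in> \<Psi> ` \<Omega>"
    then show "w \<in> \<Omega>" by (auto simp: \<Psi>_def \<Omega>_def)
  next
    fix w assume "w \<in> \<Omega>"
    then have x: "Re w > r" by (simp add: \<Omega>_def)
    define x where "x = Re w"
    \<comment> \<open>At slope at least \<open>m x\<close>, a vertical move of length
      \<open>M\<close> from height 0 changes \<open>V\<close> by at least the gap to
      \<open>Im w\<close>, so the values at -M and M enclose \<open>Im w\<close>.\<close>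
    define M where "M = \<bar>Im w - V (Complex x 0)\<bar> / m x"
    have mx: "m x > 0" using m x by (simp add: x_def)
    have M0: "M \<ge> 0" using mx by (simp add: M_def)
    have mM: "m x * M = \<bar>Im w - V (Complex x 0)\<bar>" using mx by (simp add: M_def)
    have "V (Complex x (-M)) \<le> Im w" "Im w \<le> V (Complex x M)"
      using V_grow[of x "-M" 0] V_grow[of x 0 M] x M0 mM by (auto simp: x_def)
    moreover have "continuous_on {-M..M} (\<lambda>y. V (Complex x y))"
    proof (intro continuous_at_imp_continuous_on ballI)
      fix y
      show "isCont (\<lambda>y. V (Complex x y)) y"
        using V_line[of x y] x by (intro DERIV_isCont) (auto simp: x_def)
    qed
    ultimately obtain y where "V (Complex x y) = Im w"
      using IVT'[of "\<lambda>y. V (Complex x y)" "-M" "Im w" M] M0 by auto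
    then have "\<Psi> (Complex x y) = w" by (simp add: \<Psi>_def x_def complex_eq_iff)
    then show "w \<in> \<Psi> ` \<Omega>" using x by (intro image_eqI[of _ _ "Complex x y"]) (auto simp: \<Omega>_def x_def)
  qed
  define N where "N = the_inv_into \<Omega> \<Psi>"
  have N\<Psi>: "N (\<Psi> k) = k" if "k \<in> \<Omega>" for k
    unfolding N_def by (rule the_inv_into_f_f[OF inj that])
  have N_in: "N w \<in> \<Omega>" and \<Psi>N: "\<Psi> (N w) = w" if "w \<in> \<Omega>" for w
    using that the_inv_into_into[OF inj, of w \<Omega>] f_the_inv_into_f[OF inj, of w]
    by (auto simp: N_def img)
  \<comment> \<open>The inverse of the triangular derivative of \<open>\<Psi>\<close>: solve Im
    (\<Delta> e) = Im \<Delta> Re e + Re \<Delta> Im e for Im e.\<close>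
  define N' where "N' = (\<lambda>k e. Complex (Re e) ((Im e - Im (\<Delta> k) * Re e) / Re (\<Delta> k)))"
  have N_deriv: "(N has_derivative N' (N w)) (at w)" if w: "w \<in> \<Omega>" for w
  proof -
    have "(\<lambda>e. Complex (Re e) (Im (\<Delta> (N w) * e))) \<circ> N' (N w) = id"
      using Re\<Delta>[OF N_in[OF w]] by (auto simp: fun_eq_iff N'_def complex_eq_iff)
    from has_derivative_inverse_on[where f = \<Psi> and g = N and g' = "\<lambda>_. N' (N w)"
        and f' = "\<lambda>k e. Complex (Re e) (Im (\<Delta> k * e))", OF opn \<Psi>_deriv N\<Psi> this N_in[OF w]]
    show ?thesis by (simp add: \<Psi>N w)
  qed
  have \<Phi>_deriv: "(\<Phi> has_derivative (\<lambda>e. p' k * e + cnj (q' k * e))) (at k)" if "k \<in> \<Omega>" for k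
    using p[OF that] q[OF that] unfolding \<Phi>_def has_field_derivative_def
    by (intro derivative_intros)
  define G where "G = (\<lambda>w. \<Phi> (N w))"
  have G_deriv: "(G has_derivative
       (\<lambda>e. p' (N w) * N' (N w) e + cnj (q' (N w) * N' (N w) e))) (at w)" if "w \<in> \<Omega>" for w
    unfolding G_def
    by (rule has_derivative_compose[OF N_deriv[OF that] \<Phi>_deriv[OF N_in[OF that]]])
  have \<Phi>G: "\<Phi> k = G (\<Psi> k)" if "k \<in> \<Omega>" for k
    by (simp add: G_def N\<Psi> that)
  have Im_G: "Im (G w) = Im w" if "w \<in> \<Omega>" for w
  proof -
    have "Im (\<Phi> (N w)) = V (N w)" by (simp add: \<Phi>_def V_def)
    also have "\<dots> = Im (\<Psi> (N w))" by (simp add: \<Psi>_def)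
    finally show ?thesis by (simp add: G_def \<Psi>N that)
  qed
  have Re_G: "Re (G (Complex x1 t)) < Re (G (Complex x2 t))" if x1: "r < x1" and x12: "x1 < x2" for x1 x2 t
  proof (rule DERIV_pos_imp_increasing[OF x12])
    fix x assume "x1 \<le> x"
    then have w: "Complex x t \<in> \<Omega>" using x1 by (simp add: \<Omega>_def)
    define k where "k = N (Complex x t)"
    have k: "k \<in> \<Omega>" unfolding k_def by (rule N_in[OF w])
    have "((\<lambda>x. of_real x + \<i> * of_real t) has_derivative (\<lambda>s. of_real s)) (at x)"
      by (auto intro!: derivative_eq_intros)
    then have "((\<lambda>x. Complex x t) has_derivative (\<lambda>s. of_real s)) (at x)"
      by (simp add: Complex_eq)
    from has_derivative_Re[OF has_derivative_compose[OF this G_deriv[OF w]]]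
    have "((\<lambda>x. Re (G (Complex x t))) has_derivative
       (\<lambda>s. Re (p' k * N' k (of_real s) + cnj (q' k * N' k (of_real s))))) (at x)"
      by (simp add: k_def)
    \<comment> \<open>A quotient of Jacobians: |p'|^2 - |q'|^2 belongs to \<open>\<Phi>\<close> and
      Re \<Delta> to \<open>\<Psi>\<close>. Since \<open>G\<close> preserves imaginary parts, its
      horizontal derivative is its whole Jacobian.\<close>
    moreover have "Re (p' k * N' k (of_real s) + cnj (q' k * N' k (of_real s))) =
        ((norm (p' k))\<^sup>2 - (norm (q' k))\<^sup>2) / Re (\<Delta> k) * s" for s
      using Re\<Delta>[OF k] unfolding N'_def cmod_power2
      by (simp add: divide_simps) (simp add: \<Delta>_def algebra_simps power2_eq_square)
    ultimately have "((\<lambda>x. Re (G (Complex x t))) has_real_derivative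
        ((norm (p' k))\<^sup>2 - (norm (q' k))\<^sup>2) / Re (\<Delta> k)) (at x)"
      unfolding has_field_derivative_def by (simp only:)
    moreover have "((norm (p' k))\<^sup>2 - (norm (q' k))\<^sup>2) / Re (\<Delta> k) > 0"
      using J[OF k] Re\<Delta>[OF k] by (simp add: power_strict_mono)
    ultimately show "\<exists>l. ((\<lambda>x. Re (G (Complex x t))) has_real_derivative l) (at x) \<and> 0 < l"
      by blast
  qed
  have G_inj: "inj_on G \<Omega>"
  proof (rule inj_onI)
    fix u v assume u: "u \<in> \<Omega>" and v: "v \<in> \<Omega>" and eq: "G u = G v"
    have I: "Im u = Im v" using Im_G u v eq by metis
    have "Re u = Re v"
    proof (rule ccontr)
      assume "Re u \<noteq> Re v"
      then consider "Re u < Re v" | "Re v < Re u" by linarith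
      then show False
      proof cases
        case 1
        then show ?thesis using Re_G[of "Re u" "Re v" "Im u"] u eq by (auto simp: \<Omega>_def I) (simp add: I[symmetric])
      next
        case 2
        then show ?thesis using Re_G[of "Re v" "Re u" "Im u"] v eq by (auto simp: \<Omega>_def I) (simp add: I[symmetric])
      qed
    qed
    then show "u = v" using I by (simp add: complex_eq_iff)
  qed
  have "inj_on (G \<circ> \<Psi>) \<Omega>"
    using inj G_inj by (intro comp_inj_on) (auto simp: img)
  then show "inj_on (\<lambda>k. p k + cnj (q k)) \<Omega>"
    unfolding \<Phi>_def[symmetric] using \<Phi>G by (auto simp: inj_on_def)
  have "\<Phi> ` \<Omega> = G ` \<Omega>"
    using \<Phi>G img by (metis (no_types, lifting) image_cong image_image)
  \<comment> \<open>Each level set is thus the continuous image of a single horizontal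
    half-line.\<close>
  then have "\<Phi> ` \<Omega> \<inter> {w. Im w = t} = G ` (\<Omega> \<inter> {w. Im w = t})"
    using Im_G by auto
  moreover have "connected (\<Omega> \<inter> {w. Im w = t})"
  proof -
    have "convex {w. Im w = t}" by (auto simp: convex_alt algebra_simps)
    then show ?thesis
      unfolding \<Omega>_def by (intro convex_connected convex_Int convex_halfspace_Re_gt)
  qed
  moreover have "continuous_on (\<Omega> \<inter> {w. Im w = t}) G"
    using G_deriv by (intro continuous_at_imp_continuous_on ballI) (auto dest: has_derivative_continuous)
  ultimately show "connected ((\<lambda>k. p k + cnj (q k)) ` \<Omega> \<inter> {w. Im w = t})"
    unfolding \<Phi>_def[symmetric] by (metis connected_continuous_image)
qed

section \<open>Second derivatives of a sheared pair\<close>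

(* T is the logarithmic derivative z h'' / h', read off from
   h' (1 - c z)^2 (1 + \<delta> \<epsilon> z^n) = 1. *)
lemma shear_derivatives:
  fixes h g :: "complex \<Rightarrow> complex" and \<epsilon> \<delta> c w :: complex and n :: nat
  defines "W \<equiv> \<delta> * \<epsilon> * w ^ n"
  defines "T \<equiv> 2 * (c * w / (1 - c * w)) - of_nat n * W / (1 + W)"
  assumes h: "h holomorphic_on \<D>" and g: "g holomorphic_on \<D>"
    and sum: "\<And>z. z \<in> \<D> \<Longrightarrow> h z + \<delta> * g z = z / (1 - c * z)"
    and dil: "\<And>z. z \<in> \<D> \<Longrightarrow> deriv g z = \<epsilon> * z ^ n * deriv h z"
    and c: "norm c = 1" and "n > 0" and w: "w \<in> \<D>"
  shows "deriv h w * (1 + W) = 1 / (1 - c * w)\<^sup>2"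
    and "w * deriv (deriv h) w = deriv h w * T"
    and "w * deriv (deriv g) w = deriv g w * (of_nat n + T)"
proof -
  have nz: "1 - c * z \<noteq> 0" if "z \<in> \<D>" for z
  proof
    assume "1 - c * z = 0"
    then have "norm (c * z) = 1" by simp
    then show False using that c by (simp add: norm_mult)
  qed
  \<comment> \<open>The reciprocal of h'. Differentiating the constant product h' X = 1 gives
    h''.\<close>
  define X where "X = (\<lambda>z. (1 - c * z)\<^sup>2 * (1 + \<delta> * \<epsilon> * z ^ n))"
  have X1: "deriv h z * X z = 1" if z: "z \<in> \<D>" for z
  proof -
    have "((\<lambda>z. h z + \<delta> * g z) has_field_derivative deriv h z + \<delta> * deriv g z) (at z)"
      by (intro DERIV_add DERIV_cmult holomorphic_derivI[OF h _ z] holomorphic_derivI[OF g _ z]) auto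
    moreover have "((\<lambda>z. z / (1 - c * z)) has_field_derivative 1 / (1 - c * z)\<^sup>2) (at z)"
      using nz[OF z] by (auto intro!: derivative_eq_intros simp: power2_eq_square)
    then have "((\<lambda>z. h z + \<delta> * g z) has_field_derivative 1 / (1 - c * z)\<^sup>2) (at z)"
      by (rule has_field_derivative_transform_within_open[of _ _ _ \<D>]) (use z sum in auto)
    ultimately have "deriv h z + \<delta> * deriv g z = 1 / (1 - c * z)\<^sup>2"
      by (rule DERIV_unique)
    then show ?thesis
      using nz[OF z] by (simp add: dil[OF z] X_def field_simps)
  qed
  have Xw: "X w = (1 - c * w)\<^sup>2 * (1 + W)" by (simp add: X_def W_def)
  have Xnz: "X w \<noteq> 0" using X1[OF w] by auto
  then have Wnz: "1 + W \<noteq> 0" by (simp add: Xw)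
  show "deriv h w * (1 + W) = 1 / (1 - c * w)\<^sup>2"
    using X1[OF w] nz[OF w] by (simp add: Xw field_simps)
  have h2: "(deriv h has_field_derivative deriv (deriv h) w) (at w)"
    by (intro holomorphic_derivI[OF holomorphic_deriv[OF h] _ w]) auto
  define X' where "X' = (1 - c * w)\<^sup>2 * (\<delta> * \<epsilon> * (of_nat n * w ^ (n - 1))) - 2 * c * (1 - c * w) * (1 + W)"
  have "(X has_field_derivative X') (at w)"
    unfolding X_def X'_def by (auto intro!: derivative_eq_intros simp: W_def power2_eq_square algebra_simps)
  from DERIV_mult[OF h2 this]
  have "((\<lambda>z. deriv h z * X z) has_field_derivative deriv (deriv h) w * X w + X' * deriv h w) (at w)" .
  moreover have "((\<lambda>z. 1) has_field_derivative 0) (at w)" by (rule DERIV_const)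
  then have "((\<lambda>z. deriv h z * X z) has_field_derivative 0) (at w)"
    by (rule has_field_derivative_transform_within_open[of _ _ _ \<D>]) (use w X1 in auto)
  ultimately have "deriv (deriv h) w * X w + X' * deriv h w = 0"
    by (rule DERIV_unique)
  then have "w * deriv (deriv h) w * X w = deriv h w * (- (w * X'))"
    by (simp add: algebra_simps add_eq_0_iff)
  moreover have "- (w * X') = T * X w"
  proof -
    \<comment> \<open>The exponent \<open>n - 1\<close> is truncated subtraction, so
      \<open>n > 0\<close> matters here.\<close>
    have wn: "w * w ^ (n - 1) = w ^ n" using \<open>n > 0\<close> by (simp add: power_eq_if)
    have "w * X' = (1 - c * w)\<^sup>2 * (\<delta> * \<epsilon> * of_nat n * (w * w ^ (n - 1))) - 2 * c * w * (1 - c * w) * (1 + W)"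
      by (simp add: X'_def algebra_simps)
    also have "\<dots> = (1 - c * w)\<^sup>2 * (of_nat n * W) - 2 * c * w * (1 - c * w) * (1 + W)"
      unfolding wn by (simp add: W_def algebra_simps)
    finally show ?thesis
      using nz[OF w] Wnz by (simp add: T_def Xw divide_simps) (simp add: algebra_simps power2_eq_square)
  qed
  ultimately show h3: "w * deriv (deriv h) w = deriv h w * T"
    using Xnz by (simp add: mult.assoc)
  \<comment> \<open>As g' is a constant times z^n h', its logarithmic derivative exceeds that of h'
    by n.\<close>
  have "((\<lambda>z. \<epsilon> * z ^ n * deriv h z) has_field_derivative
      \<epsilon> * (of_nat n * w ^ (n - 1)) * deriv h w + deriv (deriv h) w * (\<epsilon> * w ^ n)) (at w)"
    by (rule DERIV_mult[OF _ h2]) (auto intro!: derivative_eq_intros)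
  then have "(deriv g has_field_derivative
      \<epsilon> * (of_nat n * w ^ (n - 1)) * deriv h w + deriv (deriv h) w * (\<epsilon> * w ^ n)) (at w)"
    by (rule has_field_derivative_transform_within_open[of _ _ _ \<D>]) (use w dil in auto)
  then have "w * deriv (deriv g) w =
      \<epsilon> * of_nat n * (w * w ^ (n - 1)) * deriv h w + (w * deriv (deriv h) w) * (\<epsilon> * w ^ n)"
    by (simp add: DERIV_imp_deriv algebra_simps)
  also have "w * w ^ (n - 1) = w ^ n" using \<open>n > 0\<close> by (simp add: power_eq_if)
  finally show "w * deriv (deriv g) w = deriv g w * (of_nat n + T)"
    by (simp add: h3 dil[OF w] algebra_simps)
qed

section \<open>Rotated lines and convolution with the slanted maps\<close>

text \<open>Rotation by \<open>cis (- \<alpha>)\<close> makes the line horizontal, so convexity in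
  the direction \<open>\<alpha>\<close> can be tested on level sets of the imaginary part.\<close>

lemma rotated_mem_line_iff:
  "cis \<alpha> * u \<in> range (\<lambda>t::real. P + of_real t * cis \<alpha>) \<longleftrightarrow> Im u = Im (cis (- \<alpha>) * P)"
proof
  have cc: "cis (- \<alpha>) * (cis \<alpha> * v) = v" "cis \<alpha> * (cis (- \<alpha>) * v) = v" for v
    by (simp_all add: mult.assoc [symmetric] cis_mult)
  {
    assume "cis \<alpha> * u \<in> range (\<lambda>t::real. P + of_real t * cis \<alpha>)"
    then obtain t :: real where "cis \<alpha> * u = P + of_real t * cis \<alpha>" by auto
    then have "cis (- \<alpha>) * (cis \<alpha> * u) = cis (- \<alpha>) * P + of_real t * (cis (- \<alpha>) * (cis \<alpha> * 1))"
      by (simp add: algebra_simps)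
    then have "u = cis (- \<alpha>) * P + of_real t" unfolding cc by simp
    then show "Im u = Im (cis (- \<alpha>) * P)" by simp
  }
  assume "Im u = Im (cis (- \<alpha>) * P)"
  then have "u = cis (- \<alpha>) * P + of_real (Re u - Re (cis (- \<alpha>) * P))"
    by (simp add: complex_eq_iff)
  then have "cis \<alpha> * u = cis \<alpha> * (cis (- \<alpha>) * P) + cis \<alpha> * of_real (Re u - Re (cis (- \<alpha>) * P))"
    by (metis distrib_left)
  then have "cis \<alpha> * u = P + of_real (Re u - Re (cis (- \<alpha>) * P)) * cis \<alpha>"
    unfolding cc by (simp only: mult.commute)
  then show "cis \<alpha> * u \<in> range (\<lambda>t::real. P + of_real t * cis \<alpha>)" by blast
qed

lemma hadamard_h_slant:
  assumes "p holomorphic_on \<D>" "p 0 = 0" "z \<in> \<D>"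
  shows "hadamard p (h_slant a \<gamma>) z = cis (- \<gamma>) *
           (of_real ((1 + a) / 2) * p (cis \<gamma> * z) +
            of_real ((1 - a) / 2) * (cis \<gamma> * z * deriv p (cis \<gamma> * z)))"
proof -
  have "h_slant a \<gamma> =
      (\<lambda>z. of_real ((1 + a) / 2) * I_map \<gamma> z + of_real ((1 - a) / 2) * (z * deriv (I_map \<gamma>) z))"
    by (simp add: fun_eq_iff h_slant_def field_simps)
  then show ?thesis by (simp only: hadamard_I_map_combination[OF assms])
qed

text \<open>The outer factor \<open>cis (2 * \<gamma>)\<close> of the slanted map meets
  \<open>cis (- \<gamma>)\<close> from the kernel and leaves \<open>cis \<gamma>\<close>.\<close>

lemma hadamard_g_slant:
  assumes "p holomorphic_on \<D>" "p 0 = 0" "z \<in> \<D>"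
  shows "hadamard p (g_slant a \<gamma>) z = cis \<gamma> *
           (of_real ((1 + a) / 2) * p (cis \<gamma> * z) -
            of_real ((1 - a) / 2) * (cis \<gamma> * z * deriv p (cis \<gamma> * z)))"
proof -
  have "g_slant a \<gamma> =
      (\<lambda>z. cis (2 * \<gamma>) * of_real ((1 + a) / 2) * I_map \<gamma> z +
           - (cis (2 * \<gamma>) * of_real ((1 - a) / 2)) * (z * deriv (I_map \<gamma>) z))"
    by (simp add: fun_eq_iff g_slant_def field_simps)
  then have "hadamard p (g_slant a \<gamma>) z = cis (- \<gamma>) *
      (cis (2 * \<gamma>) * of_real ((1 + a) / 2) * p (cis \<gamma> * z) +
       - (cis (2 * \<gamma>) * of_real ((1 - a) / 2)) * (cis \<gamma> * z * deriv p (cis \<gamma> * z)))"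
    by (simp only: hadamard_I_map_combination[OF assms])
  also have "\<dots> = (cis (- \<gamma>) * cis (2 * \<gamma>)) *
      (of_real ((1 + a) / 2) * p (cis \<gamma> * z) -
       of_real ((1 - a) / 2) * (cis \<gamma> * z * deriv p (cis \<gamma> * z)))"
    by (simp add: algebra_simps)
  finally show ?thesis by (simp add: cis_mult)
qed

section \<open>The convolution in the half-plane coordinate\<close>

theorem theorem2:
  fixes \<gamma> \<gamma>1 \<theta> a :: real and n :: nat and h g :: "complex \<Rightarrow> complex"
  assumes "0 \<le> \<gamma>" and "\<gamma> < 2 * pi" and "0 \<le> \<gamma>1" and "\<gamma>1 < 2 * pi"
    and "n > 0"
    and "(h, g) \<in> SH0_half_plane \<gamma>1"
    and "\<And>z. z \<in> \<D> \<Longrightarrow> h z + cis (- 2 * \<gamma>1) * g z = z / (1 - cis \<gamma>1 * z)"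
    and "\<And>z. z \<in> \<D> \<Longrightarrow> deriv g z / deriv h z = cis \<theta> * z ^ n"
    and "(real n - 2) / (real n + 2) \<le> a" and "a < 1"
  shows "convex_in_direction (- (\<gamma>1 + \<gamma>)) (harmonic_map ((h, g) \<^bold>* f_slant a \<gamma>))"
proof -
  define \<epsilon> where "\<epsilon> = cis \<theta>"
  define \<delta> where "\<delta> = cis (- 2 * \<gamma>1)"
  define A where "A = complex_of_real ((1 + a) / 2)"
  define B where "B = complex_of_real ((1 - a) / 2)"
  have AB: "A + B = 1" "A - B = of_real a" "B * 2 = of_real (1 - a)"
    by (simp_all add: A_def B_def field_simps)
  have hol: "h holomorphic_on \<D>" "g holomorphic_on \<D>" and h0: "h 0 = 0" "g 0 = 0"
    and sp: "\<And>z. z \<in> \<D> \<Longrightarrow> norm (deriv g z) < norm (deriv h z)"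
    using assms(6) by (auto simp: SH0_half_plane_def class_SH_def class_H_def)
  have sum: "h z + \<delta> * g z = z / (1 - cis \<gamma>1 * z)" if "z \<in> \<D>" for z
    using assms(7)[OF that] by (simp add: \<delta>_def)
  have dil: "deriv g z = \<epsilon> * z ^ n * deriv h z" if "z \<in> \<D>" for z
  proof -
    have "deriv h z \<noteq> 0" using sp[OF that] by auto
    then show ?thesis using assms(8)[OF that] by (simp add: \<epsilon>_def field_simps)
  qed
  have der2: "(deriv u has_field_derivative deriv (deriv u) z) (at z)"
    if "u holomorphic_on \<D>" "z \<in> \<D>" for u z
    by (intro holomorphic_derivI[OF holomorphic_deriv[OF that(1)] _ that(2)]) auto
  have der1: "(u has_field_derivative deriv u z) (at z)"
    if "u holomorphic_on \<D>" "z \<in> \<D>" for u z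
    by (intro holomorphic_derivI[OF that(1) _ that(2)]) auto

  define \<Omega> where "\<Omega> = {k. Re k > - 1/2}"
  \<comment> \<open>The convolution evaluates \<open>h\<close> and \<open>g\<close> at
    \<open>cis \<gamma> * z\<close>, and their shear has its pole where \<open>cis \<gamma>1\<close>
    times the argument is 1; hence the angle \<gamma> + \<gamma>1.\<close>
  define M where "M = (\<lambda>z. cis (\<gamma> + \<gamma>1) * z / (1 - cis (\<gamma> + \<gamma>1) * z))"
  have M: "bij_betw M \<D> \<Omega>" unfolding M_def \<Omega>_def by (rule moebius_bij)
  \<comment> \<open>The evaluation point \<open>cis \<gamma> * z\<close> expressed through k = M
    z.\<close>
  define v where "v = (\<lambda>k. cis (- \<gamma>1) * (k / (1 + k)))"
  have vM: "v (M z) = cis \<gamma> * z" if "z \<in> \<D>" for z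
  proof -
    have "1 - cis (\<gamma> + \<gamma>1) * z \<noteq> 0" using that by (rule slant_denom_nz)
    then have "M z / (1 + M z) = cis (\<gamma> + \<gamma>1) * z" by (simp add: M_def divide_simps)
    then have "v (M z) = cis (- \<gamma>1) * (cis (\<gamma> + \<gamma>1) * z)" by (simp only: v_def)
    then show ?thesis by (simp add: mult.assoc [symmetric] cis_mult)
  qed
  have v_in: "v k \<in> \<D>" if k: "k \<in> \<Omega>" for k
  proof -
    obtain z where "z \<in> \<D>" "k = M z" using k bij_betw_imp_surj_on[OF M] by blast
    then show ?thesis by (simp add: vM norm_mult)
  qed
  have k1: "1 + k \<noteq> 0" if "k \<in> \<Omega>" for k
    using that by (auto simp: \<Omega>_def complex_eq_iff)
  have v_deriv: "(v has_field_derivative cis (- \<gamma>1) / (1 + k)\<^sup>2) (at k)" if "k \<in> \<Omega>" for k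
    using k1[OF that] unfolding v_def
    by (auto intro!: derivative_eq_intros simp: power2_eq_square distrib_left)
  have cv: "cis \<gamma>1 * v k = k / (1 + k)" for k
    unfolding v_def mult.assoc [symmetric] cis_mult by simp

  \<comment> \<open>The two parts of the convolution, with unimodular factors chosen so that p + cnj
    q is the convolution rotated by \<gamma> + \<gamma>1.\<close>
  define p where "p = (\<lambda>k. cis \<gamma>1 * (A * h (v k) + B * (v k * deriv h (v k))))"
  define q where "q = (\<lambda>k. cis (- \<gamma>1) * (A * g (v k) - B * (v k * deriv g (v k))))"
  define W where "W = (\<lambda>k. \<delta> * \<epsilon> * v k ^ n)"
  define T where "T = (\<lambda>k. 2 * k - of_nat n * W k / (1 + W k))"
  \<comment> \<open>The factor (1 + k)^2 of h' at \<open>v k\<close> cancels against the one in the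
    derivative of \<open>v\<close>, leaving only 1 + W below.\<close>
  define p' where "p' = (\<lambda>k. (1 + B * T k) / (1 + W k))"
  define q' where "q' = (\<lambda>k. W k * (of_real a - B * (of_nat n + T k)) / (1 + W k))"
  have normW: "norm (W k) < 1" if "k \<in> \<Omega>" for k
  proof -
    have "norm (v k) ^ n < 1" using v_in[OF that] \<open>n > 0\<close> by (simp add: power_less_one_iff)
    then show ?thesis by (simp add: W_def \<delta>_def \<epsilon>_def norm_mult norm_power)
  qed
  have W1: "1 + W k \<noteq> 0" if "k \<in> \<Omega>" for k
    using normW[OF that] by (metis add_eq_0_iff2 less_irrefl norm_minus_cancel norm_one)
  have shear: "deriv h (v k) = (1 + k)\<^sup>2 / (1 + W k)"
      "v k * deriv (deriv h) (v k) = deriv h (v k) * T k"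
      "v k * deriv (deriv g) (v k) = deriv g (v k) * (of_nat n + T k)" if k: "k \<in> \<Omega>" for k
  proof -
    note sh = shear_derivatives[OF hol sum dil norm_cis \<open>n > 0\<close> v_in[OF k]]
    have W_eq: "\<delta> * \<epsilon> * v k ^ n = W k" by (simp add: W_def)
    have 1: "1 - cis \<gamma>1 * v k = 1 / (1 + k)" using k1[OF k] by (simp add: cv field_simps)
    have "cis \<gamma>1 * v k / (1 - cis \<gamma>1 * v k) = k" unfolding 1 using k1[OF k] by (simp add: cv)
    then have T_eq: "T k = 2 * (cis \<gamma>1 * v k / (1 - cis \<gamma>1 * v k)) -
        of_nat n * (\<delta> * \<epsilon> * v k ^ n) / (1 + \<delta> * \<epsilon> * v k ^ n)"
      by (simp add: T_def W_def)
    show "deriv h (v k) = (1 + k)\<^sup>2 / (1 + W k)"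
      using sh(1) W1[OF k] unfolding 1 W_eq by (simp add: nonzero_eq_divide_eq power_divide)
    show "v k * deriv (deriv h) (v k) = deriv h (v k) * T k"
      using sh(2) unfolding T_eq .
    show "v k * deriv (deriv g) (v k) = deriv g (v k) * (of_nat n + T k)"
      using sh(3) unfolding T_eq .
  qed
  have p_deriv: "(p has_field_derivative p' k) (at k)" if k: "k \<in> \<Omega>" for k
  proof -
    have "((\<lambda>w. A * h w + B * (w * deriv h w)) has_field_derivative
        A * deriv h (v k) + B * (1 * deriv h (v k) + deriv (deriv h) (v k) * v k)) (at (v k))"
      by (intro DERIV_add DERIV_cmult DERIV_mult DERIV_ident der1 der2 hol v_in k)
    from DERIV_cmult[OF DERIV_chain2[OF this v_deriv[OF k]], of "cis \<gamma>1"]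
    have "(p has_field_derivative cis \<gamma>1 *
        ((A * deriv h (v k) + B * (1 * deriv h (v k) + deriv (deriv h) (v k) * v k)) *
         (cis (- \<gamma>1) / (1 + k)\<^sup>2))) (at k)"
      by (simp add: p_def)
    moreover have "cis \<gamma>1 *
        ((A * deriv h (v k) + B * (1 * deriv h (v k) + deriv (deriv h) (v k) * v k)) *
         (cis (- \<gamma>1) / (1 + k)\<^sup>2)) = p' k"
    proof -
      have "A * deriv h (v k) + B * (1 * deriv h (v k) + deriv (deriv h) (v k) * v k) =
          (A + B) * deriv h (v k) + B * (v k * deriv (deriv h) (v k))"
        by (simp add: algebra_simps)
      also have "\<dots> = deriv h (v k) * (1 + B * T k)"
        unfolding AB shear(2)[OF k] by (simp add: algebra_simps)
      finally have e: "A * deriv h (v k) + B * (1 * deriv h (v k) + deriv (deriv h) (v k) * v k) =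
          (1 + k)\<^sup>2 / (1 + W k) * (1 + B * T k)"
        unfolding shear(1)[OF k] .
      have cancel: "cis \<gamma>1 * (X * (cis (- \<gamma>1) / (1 + k)\<^sup>2)) = X / (1 + k)\<^sup>2" for X
        by (simp add: cis_mult mult.left_commute[of _ X])
      show ?thesis
        unfolding e cancel p'_def using k1[OF k] by simp
    qed
    ultimately show ?thesis by simp
  qed
  have q_deriv: "(q has_field_derivative q' k) (at k)" if k: "k \<in> \<Omega>" for k
  proof -
    have "((\<lambda>w. A * g w - B * (w * deriv g w)) has_field_derivative
        A * deriv g (v k) - B * (1 * deriv g (v k) + deriv (deriv g) (v k) * v k)) (at (v k))"
      by (intro DERIV_diff DERIV_cmult DERIV_mult DERIV_ident der1 der2 hol v_in k)
    from DERIV_cmult[OF DERIV_chain2[OF this v_deriv[OF k]], of "cis (- \<gamma>1)"]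
    have "(q has_field_derivative cis (- \<gamma>1) *
        ((A * deriv g (v k) - B * (1 * deriv g (v k) + deriv (deriv g) (v k) * v k)) *
         (cis (- \<gamma>1) / (1 + k)\<^sup>2))) (at k)"
      by (simp add: q_def)
    moreover have "cis (- \<gamma>1) *
        ((A * deriv g (v k) - B * (1 * deriv g (v k) + deriv (deriv g) (v k) * v k)) *
         (cis (- \<gamma>1) / (1 + k)\<^sup>2)) = q' k"
    proof -
      have "A * deriv g (v k) - B * (1 * deriv g (v k) + deriv (deriv g) (v k) * v k) =
          (A - B) * deriv g (v k) - B * (v k * deriv (deriv g) (v k))"
        by (simp add: algebra_simps)
      also have "\<dots> = deriv g (v k) * (of_real a - B * (of_nat n + T k))"
        unfolding AB shear(3)[OF k] by (simp add: algebra_simps)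
      finally have e: "A * deriv g (v k) - B * (1 * deriv g (v k) + deriv (deriv g) (v k) * v k) =
          \<epsilon> * v k ^ n * ((1 + k)\<^sup>2 / (1 + W k)) * (of_real a - B * (of_nat n + T k))"
        unfolding dil[OF v_in[OF k]] shear(1)[OF k] .
      \<comment> \<open>For \<open>p\<close> the two rotations cancel; here they combine to
        \<delta>, which turns \<epsilon> v^n into \<open>W\<close>.\<close>
      have "cis (- \<gamma>1) * cis (- \<gamma>1) = \<delta>" by (simp add: \<delta>_def cis_mult)
      then have cancel: "cis (- \<gamma>1) * (X * (cis (- \<gamma>1) / (1 + k)\<^sup>2)) = \<delta> * X / (1 + k)\<^sup>2" for X
        by (simp add: mult.left_commute[of _ X] mult.commute)
      have "cis (- \<gamma>1) *
        ((A * deriv g (v k) - B * (1 * deriv g (v k) + deriv (deriv g) (v k) * v k)) *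
         (cis (- \<gamma>1) / (1 + k)\<^sup>2)) = W k / (1 + W k) * (of_real a - B * (of_nat n + T k))"
        unfolding e cancel using k1[OF k] W1[OF k] by (simp add: W_def divide_simps)
      then show ?thesis
        unfolding q'_def by simp
    qed
    ultimately show ?thesis by simp
  qed
  define P where "P = (\<lambda>k. (1 - W k) / (1 + W k))"
  have ReP: "Re (P k) > 0" if "k \<in> \<Omega>" for k
    unfolding P_def using normW[OF that] by (rule Re_one_minus_over_one_plus_pos)
  have locally_univalent: "norm (q' k) < norm (p' k)" if k: "k \<in> \<Omega>" for k
  proof -
    have "norm (W k * (2 * of_real a - of_real (1 - a) * (of_real (real n) + T k))) <
          norm (2 + of_real (1 - a) * T k)"
    proof (rule dilatation_bound[where Q = "1 + 2 * k" and P = "P k"])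
      \<comment> \<open>By the definition of \<open>P\<close>, W / (1 + W) = (1 - P) / 2.\<close>
      show "T k = 1 + 2 * k - 1 - of_real (real n / 2) * (1 - P k)"
        using W1[OF k] by (simp add: T_def P_def field_simps)
    qed (use k ReP[OF k] normW[OF k] assms(9,10) in \<open>auto simp: \<Omega>_def\<close>)
    moreover have "2 + of_real (1 - a) * T k = 2 * (1 + B * T k)"
      and "W k * (2 * of_real a - of_real (1 - a) * (of_real (real n) + T k)) =
           2 * (W k * (of_real a - B * (of_nat n + T k)))"
      unfolding AB(3)[symmetric] by (simp_all add: algebra_simps)
    ultimately have "norm (2 * (W k * (of_real a - B * (of_nat n + T k)))) < norm (2 * (1 + B * T k))"
      by metis
    then have "norm (W k * (of_real a - B * (of_nat n + T k))) < norm (1 + B * T k)"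
      unfolding norm_mult[of 2] by simp
    then show ?thesis
      unfolding p'_def q'_def norm_divide using W1[OF k] by (intro divide_strict_right_mono) auto
  qed
  have diff: "p' k - q' k = A * P k + B * (1 + 2 * k)" if k: "k \<in> \<Omega>" for k
  proof -
    \<comment> \<open>Multiplying by 1 + W exposes - n W, which cancels the n W coming from g''; the
      difference p' - q' then has no explicit n.\<close>
    have TW: "T k * (1 + W k) = 2 * k * (1 + W k) - of_nat n * W k"
      using W1[OF k] by (simp add: T_def left_diff_distrib)
    have "1 + B * T k - W k * (of_real a - B * (of_nat n + T k)) =
        1 - of_real a * W k + B * (T k * (1 + W k) + of_nat n * W k)"
      by (simp add: algebra_simps)
    also have "\<dots> = A * (1 - W k) + B * (1 + 2 * k) * (1 + W k)"
    proof -
      have A_eq: "A = 1 - B" and a_eq: "of_real a = 1 - 2 * B"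
        using AB by (simp_all add: algebra_simps)
      show ?thesis unfolding TW A_eq a_eq by (simp add: algebra_simps)
    qed
    finally show ?thesis
      unfolding p'_def q'_def P_def diff_divide_distrib[symmetric]
      using W1[OF k] by (simp add: add_divide_distrib)
  qed
  have "a > -1"
  proof -
    \<comment> \<open>Equivalent to 2 n > 0; it keeps the coefficient of P positive below.\<close>
    have "(real n - 2) / (real n + 2) > -1" using \<open>n > 0\<close> by (simp add: field_simps)
    then show ?thesis using assms(9) by linarith
  qed
  \<comment> \<open>Dropping the term with P leaves a bound that depends on Re k alone, as the role
    of \<open>m\<close> requires.\<close>
  have lower: "(1 - a) / 2 * (1 + 2 * Re k) \<le> Re (p' k - q' k)" if k: "k \<in> \<Omega>" for k
  proof -
    have "(1 + a) / 2 * Re (P k) \<ge> 0" using \<open>a > -1\<close> ReP[OF k] by simp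
    moreover have "Re (of_real r * z) = r * Re z" for r z by simp
    ultimately show ?thesis unfolding diff[OF k] A_def B_def plus_complex.sel by simp
  qed
  define \<Phi> where "\<Phi> = (\<lambda>k. p k + cnj (q k))"
  have "(1 - a) / 2 * (1 + 2 * x) > 0" if "x > - 1/2" for x
    using that \<open>a < 1\<close> by (intro mult_pos_pos) auto
  note convex = horizontally_convex_half_plane[where p = p and q = q and p' = p' and q' = q'
      and m = "\<lambda>x. (1 - a) / 2 * (1 + 2 * x)" and r = "- 1/2", folded \<Omega>_def \<Phi>_def,
      OF p_deriv q_deriv locally_univalent this lower]

  define \<alpha> where "\<alpha> = - (\<gamma>1 + \<gamma>)"
  define F where "F = harmonic_map ((h, g) \<^bold>* f_slant a \<gamma>)"
  have F: "F z = cis \<alpha> * \<Phi> (M z)" if z: "z \<in> \<D>" for z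
  proof -
    \<comment> \<open>Conjugation inverts the unimodular factor of Y, so both sides equal
      \<open>cis (- \<gamma>)\<close> times X + cnj Y.\<close>
    have rotate: "cis (- \<gamma>) * X + cnj (cis \<gamma> * Y) =
        cis \<alpha> * (cis \<gamma>1 * X + cnj (cis (- \<gamma>1) * Y))" for X Y
      by (simp add: \<alpha>_def distrib_left cis_cnj cis_mult mult.assoc [symmetric])
    show ?thesis
      unfolding F_def harmonic_map_def harmonic_conv_def f_slant_def fst_conv snd_conv
        hadamard_h_slant[OF hol(1) h0(1) z] hadamard_g_slant[OF hol(2) h0(2) z]
        \<Phi>_def p_def q_def vM[OF z] A_def[symmetric] B_def[symmetric]
      by (rule rotate)
  qed
  have "inj_on (\<Phi> \<circ> M) \<D>"
    using M convex(1) by (auto simp: bij_betw_def intro: comp_inj_on)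
  then have "inj_on F \<D>"
    by (auto simp: inj_on_def F)
  moreover have "connected (F ` \<D> \<inter> range (\<lambda>t::real. z + of_real t * cis \<alpha>))" for z
  proof -
    have "F ` \<D> = (\<lambda>u. cis \<alpha> * u) ` (\<Phi> ` \<Omega>)"
      unfolding bij_betw_imp_surj_on[OF M, symmetric] image_image by (simp add: F)
    then have "F ` \<D> \<inter> range (\<lambda>t::real. z + of_real t * cis \<alpha>) =
        (\<lambda>u. cis \<alpha> * u) ` (\<Phi> ` \<Omega> \<inter> {u. Im u = Im (cis (- \<alpha>) * z)})"
      unfolding rotated_mem_line_iff[symmetric] by (simp only:) blast
    then show ?thesis
      by (simp only:) (intro connected_continuous_image continuous_intros convex(2))
  qed
  ultimately show ?thesis
    unfolding convex_in_direction_def F_def \<alpha>_def by blast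
qed

end
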